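(* Let $X_1\subset X_0$ and $Y_1\subset Y_0$ be four normed spaces, let $0<\alpha\leq1$, and let $\mathcal T$ be a mapping from $X_i$ into $Y_i$ which is globally $\alpha$-Hölderian for $i=0,1$. Let $0\leq\theta\leq 1$, $1\leq p\leq+\infty$, $\lambda\in\mathbb R$. If $X_1$ is dense in $X_0$, then $\mathcal T$ is an $\alpha$-Hölderian mapping from $(X_0,X_1)_{\theta,p;\lambda}$ into $(Y_0,Y_1)_{\theta,\frac p\alpha;\lambda\alpha}$.
   Context: Each couple of normed spaces is compatible (continuously embedded in a common Hausdorff topological vector space). A mapping $\mathcal T$ is (globally) $\alpha$-Hölderian from $E$ into $F$ if there is a constant $M>0$ such that $\|\mathcal T a-\mathcal T b\|_F\leq M\|a-b\|_E^\alpha$ for all $a,b\in E$ (in particular $\mathcal T a-\mathcal T b\in F$). For a compatible couple $(X_0,X_1)$, $g\in X_0+X_1$, $t>0$: $K(g,t)=\inf_{g=g_0+g_1}(\|g_0\|_{X_0}+t\|g_1\|_{X_1})$. For $0\leq\theta\leq1$, $1\leq q\leq+\infty$, $\lambda\in\mathbb R$, $$(X_0,X_1)_{\theta,q;\lambda}=\Big\{g\in X_0+X_1:\ \|g\|_{\theta,q;\lambda}=\big\|t^{-\theta-\frac1q}(1-\log t)^\lambda K(g,t)\big\|_{L^q(0,1)}<+\infty\Big\},$$ where $1/q=0$ if $q=\infty$; also $p/\alpha=\infty$ if $p=\infty$. *)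

theory Defs
  imports "HOL-Probability.Essential_Supremum"
begin

text \<open>A normed space is a linear subspace \<open>carr X\<close> of an ambient real vector space \<open>'v\<close> together
  with a norm \<open>nrm X\<close>, whose values outside \<open>carr X\<close> are irrelevant. With both spaces of a couple
  inside the same \<open>'v\<close>, inclusions and sums of spaces are plain inclusions and sums of sets.
  Complex normed spaces are covered through their underlying real structure.\<close>

record 'v nspace =
  carr :: "'v set"
  nrm :: "'v \<Rightarrow> real"

definition normed_space :: "'v::real_vector nspace \<Rightarrow> bool" where
  "normed_space X \<longleftrightarrow>
     subspace (carr X) \<and>
     (\<forall>x\<in>carr X. 0 \<le> nrm X x) \<and>
     (\<forall>x\<in>carr X. nrm X x = 0 \<longleftrightarrow> x = 0) \<and>
     (\<forall>c. \<forall>x\<in>carr X. nrm X (c *\<^sub>R x) = \<bar>c\<bar> * nrm X x) \<and>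
     (\<forall>x\<in>carr X. \<forall>y\<in>carr X. nrm X (x + y) \<le> nrm X x + nrm X y)"

text \<open>\<open>Metric_space\<close> demands a nonnegative symmetric distance on the whole type, hence the value 0
  off the carrier.\<close>

definition ndist :: "'v::real_vector nspace \<Rightarrow> 'v \<Rightarrow> 'v \<Rightarrow> real" where
  "ndist X x y = (if x \<in> carr X \<and> y \<in> carr X then nrm X (x - y) else 0)"

definition norm_topology :: "'v::real_vector nspace \<Rightarrow> 'v topology" where
  "norm_topology X = Metric_space.mtopology (carr X) (ndist X)"

lemma Metric_space_ndist:
  assumes "normed_space X"
  shows "Metric_space (carr X) (ndist X)"
proof -
  have sub: "subspace (carr X)"
    and nonneg: "\<And>x. x \<in> carr X \<Longrightarrow> 0 \<le> nrm X x"
    and zero: "\<And>x. x \<in> carr X \<Longrightarrow> nrm X x = 0 \<longleftrightarrow> x = 0"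
    and scale: "\<And>c x. x \<in> carr X \<Longrightarrow> nrm X (c *\<^sub>R x) = \<bar>c\<bar> * nrm X x"
    and tri: "\<And>x y. x \<in> carr X \<Longrightarrow> y \<in> carr X \<Longrightarrow> nrm X (x + y) \<le> nrm X x + nrm X y"
    using assms unfolding normed_space_def by auto
  have diff: "x - y \<in> carr X" if "x \<in> carr X" "y \<in> carr X" for x y
    using sub that by (rule subspace_diff)
  show ?thesis
  proof
    show "0 \<le> ndist X x y" for x y
      using nonneg[of "x - y"] diff[of x y] by (auto simp: ndist_def)
    show "ndist X x y = ndist X y x" for x y
      using scale[of "x - y" "-1"] diff[of x y] by (auto simp: ndist_def)
    show "ndist X x y = 0 \<longleftrightarrow> x = y" if "x \<in> carr X" "y \<in> carr X" for x y
      using that zero[of "x - y"] diff[of x y] by (auto simp: ndist_def)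
    show "ndist X x z \<le> ndist X x y + ndist X y z"
      if "x \<in> carr X" "y \<in> carr X" "z \<in> carr X" for x y z
      using that tri[of "x - y" "y - z"] diff[of x y] diff[of y z] by (auto simp: ndist_def)
  qed
qed

definition hausdorff_tvs :: "'v::real_vector topology \<Rightarrow> bool" where
  "hausdorff_tvs T \<longleftrightarrow>
     topspace T = UNIV \<and>
     Hausdorff_space T \<and>
     continuous_map (prod_topology T T) T (\<lambda>(x, y). x + y) \<and>
     continuous_map (prod_topology euclideanreal T) T (\<lambda>(c, x). c *\<^sub>R x)"

definition compatible_couple :: "'v::real_vector nspace \<Rightarrow> 'v nspace \<Rightarrow> bool" where
  "compatible_couple X\<^sub>0 X\<^sub>1 \<longleftrightarrow>
     normed_space X\<^sub>0 \<and> normed_space X\<^sub>1 \<and>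
     (\<exists>T. hausdorff_tvs T \<and>
          continuous_map (norm_topology X\<^sub>0) T (\<lambda>x. x) \<and>
          continuous_map (norm_topology X\<^sub>1) T (\<lambda>x. x))"

definition holderian ::
    "real \<Rightarrow> 'v::real_vector nspace \<Rightarrow> 'w::real_vector nspace \<Rightarrow> ('v \<Rightarrow> 'w) \<Rightarrow> bool" where
  "holderian \<alpha> E F \<T> \<longleftrightarrow>
     (\<exists>M>0. \<forall>a\<in>carr E. \<forall>b\<in>carr E.
        \<T> a - \<T> b \<in> carr F \<and> nrm F (\<T> a - \<T> b) \<le> M * nrm E (a - b) powr \<alpha>)"

definition K_fun :: "'v::real_vector nspace \<Rightarrow> 'v nspace \<Rightarrow> 'v \<Rightarrow> real \<Rightarrow> real" where
  "K_fun X\<^sub>0 X\<^sub>1 g t =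
     Inf {nrm X\<^sub>0 g\<^sub>0 + t * nrm X\<^sub>1 g\<^sub>1 | g\<^sub>0 g\<^sub>1. g\<^sub>0 \<in> carr X\<^sub>0 \<and> g\<^sub>1 \<in> carr X\<^sub>1 \<and> g = g\<^sub>0 + g\<^sub>1}"

text \<open>The \<open>L\<^sup>q(0,1)\<close> norm of a measurable function, with the value \<open>\<infinity>\<close> when it is not in \<open>L\<^sup>q\<close>.\<close>

definition Lq_norm01 :: "ennreal \<Rightarrow> (real \<Rightarrow> real) \<Rightarrow> ennreal" where
  "Lq_norm01 q f =
     (if q = \<infinity> then esssup (lebesgue_on {0<..<1}) (\<lambda>t. ennreal \<bar>f t\<bar>)
      else let I = (\<integral>\<^sup>+ t. ennreal (\<bar>f t\<bar> powr enn2real q) \<partial>lebesgue_on {0<..<1})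
           in if I = \<infinity> then \<infinity> else ennreal (enn2real I powr (1 / enn2real q)))"

text \<open>\<open>enn2real (1 / q)\<close> is \<open>1/q\<close>, and it is 0 for \<open>q = \<infinity>\<close>.\<close>

definition interp_norm ::
    "'v::real_vector nspace \<Rightarrow> 'v nspace \<Rightarrow> real \<Rightarrow> ennreal \<Rightarrow> real \<Rightarrow> 'v \<Rightarrow> ennreal" where
  "interp_norm X\<^sub>0 X\<^sub>1 \<theta> q lam g =
     Lq_norm01 q (\<lambda>t. t powr (- \<theta> - enn2real (1 / q)) * (1 - ln t) powr lam * K_fun X\<^sub>0 X\<^sub>1 g t)"

definition interp_space ::
    "'v::real_vector nspace \<Rightarrow> 'v nspace \<Rightarrow> real \<Rightarrow> ennreal \<Rightarrow> real \<Rightarrow> 'v nspace" where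
  "interp_space X\<^sub>0 X\<^sub>1 \<theta> q lam =
     \<lparr>carr = {g \<in> {g\<^sub>0 + g\<^sub>1 | g\<^sub>0 g\<^sub>1. g\<^sub>0 \<in> carr X\<^sub>0 \<and> g\<^sub>1 \<in> carr X\<^sub>1}. interp_norm X\<^sub>0 X\<^sub>1 \<theta> q lam g < \<infinity>},
      nrm = (\<lambda>g. enn2real (interp_norm X\<^sub>0 X\<^sub>1 \<theta> q lam g))\<rparr>"

end

theory Submission
  imports Defs
begin

text \<open>
  Everything rests on the inequality
  \<open>K(\<T> a - \<T> b, t\<^sup>\<alpha>; Y) \<le> C K(a - b, t; X)\<^sup>\<alpha>\<close>, proved in \<open>K_fun_holder\<close>. Given a splitting
  \<open>a - b = g\<^sub>0 + g\<^sub>1\<close>, the obvious splitting \<open>(\<T> a - \<T> (b + g\<^sub>1)) + (\<T> (b + g\<^sub>1) - \<T> b)\<close> of the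
  difference of the images fails, because the Hoelder condition between \<open>X\<^sub>1\<close> and \<open>Y\<^sub>1\<close> does not
  apply to \<open>b\<close>, which is only known to lie in \<open>X\<^sub>0\<close>. Density provides some \<open>c\<close> in \<open>X\<^sub>1\<close> that is
  close to \<open>b\<close> in \<open>X\<^sub>0\<close>. In the second summand \<open>b\<close> is replaced by \<open>c\<close>, and the first summand
  absorbs the error, which disappears in the limit because \<open>\<T>\<close> is continuous from \<open>X\<^sub>0\<close> to \<open>Y\<^sub>0\<close>.

  The rest is the substitution \<open>s = t\<^sup>\<alpha>\<close> of the unit interval onto itself. With the inequality above, it
  bounds the integral of the \<open>p/\<alpha>\<close>-th power in the target norm by a constant times the integral of
  the \<open>p\<close>-th power in the source norm: the exponents \<open>p/\<alpha>\<close> and \<open>lam * \<alpha>\<close> of the target space are chosen for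
  this, and \<open>1 - \<alpha> ln t\<close> and \<open>1 - ln t\<close> are comparable. For \<open>p = \<infinity>\<close> the substitution
  only has to preserve null sets. Both cases are in \<open>Lq_norm01_holder_substitution\<close>.

  Since the source norm is read as a real number, where the value \<open>\<infinity>\<close> would become 0, it also has to be
  shown that the norm of \<open>a - b\<close> is finite, that is, that the source space is closed under
  differences (\<open>interp_norm_diff_finite\<close>).
\<close>

section \<open>Normed spaces and the K-functional\<close>

lemma normed_spaceD:
  assumes "normed_space X"
  shows "subspace (carr X)"
    and "x \<in> carr X \<Longrightarrow> 0 \<le> nrm X x"
    and "x \<in> carr X \<Longrightarrow> y \<in> carr X \<Longrightarrow> nrm X (x + y) \<le> nrm X x + nrm X y"
    and "x \<in> carr X \<Longrightarrow> y \<in> carr X \<Longrightarrow> nrm X (x - y) \<le> nrm X x + nrm X y"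
proof -
  show sub: "subspace (carr X)" and "x \<in> carr X \<Longrightarrow> 0 \<le> nrm X x"
    using assms unfolding normed_space_def by auto
  show tri: "x \<in> carr X \<Longrightarrow> y \<in> carr X \<Longrightarrow> nrm X (x + y) \<le> nrm X x + nrm X y" for x y
    using assms unfolding normed_space_def by auto
  have neg: "x \<in> carr X \<Longrightarrow> nrm X (- x) = nrm X x" for x
    using assms unfolding normed_space_def
    by (metis abs_minus_cancel abs_one mult_1 scaleR_minus1_left)
  show "x \<in> carr X \<Longrightarrow> y \<in> carr X \<Longrightarrow> nrm X (x - y) \<le> nrm X x + nrm X y"
    using tri[of x "- y"] neg[of y] subspace_neg[OF sub, of y] by simp
qed

lemma K_fun_upper:
  assumes "normed_space X\<^sub>0" "normed_space X\<^sub>1" "g\<^sub>0 \<in> carr X\<^sub>0" "g\<^sub>1 \<in> carr X\<^sub>1" "0 \<le> t"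
  shows "K_fun X\<^sub>0 X\<^sub>1 (g\<^sub>0 + g\<^sub>1) t \<le> nrm X\<^sub>0 g\<^sub>0 + t * nrm X\<^sub>1 g\<^sub>1"
  unfolding K_fun_def
proof (rule cInf_lower)
  show "bdd_below {nrm X\<^sub>0 h\<^sub>0 + t * nrm X\<^sub>1 h\<^sub>1 |h\<^sub>0 h\<^sub>1.
          h\<^sub>0 \<in> carr X\<^sub>0 \<and> h\<^sub>1 \<in> carr X\<^sub>1 \<and> g\<^sub>0 + g\<^sub>1 = h\<^sub>0 + h\<^sub>1}"
    using assms by (intro bdd_belowI[of _ 0]) (auto intro!: add_nonneg_nonneg mult_nonneg_nonneg normed_spaceD(2))
qed (use assms in auto)

lemma K_fun_greatest:
  assumes "normed_space X\<^sub>1" "g \<in> carr X\<^sub>0"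
    and "\<And>g\<^sub>0 g\<^sub>1. \<lbrakk>g\<^sub>0 \<in> carr X\<^sub>0; g\<^sub>1 \<in> carr X\<^sub>1; g = g\<^sub>0 + g\<^sub>1\<rbrakk> \<Longrightarrow> c \<le> nrm X\<^sub>0 g\<^sub>0 + t * nrm X\<^sub>1 g\<^sub>1"
  shows "c \<le> K_fun X\<^sub>0 X\<^sub>1 g t"
  unfolding K_fun_def
proof (rule cInf_greatest)
  have "g = g + 0" "0 \<in> carr X\<^sub>1"
    using subspace_0[OF normed_spaceD(1)[OF assms(1)]] by auto
  then show "{nrm X\<^sub>0 g\<^sub>0 + t * nrm X\<^sub>1 g\<^sub>1 |g\<^sub>0 g\<^sub>1. g\<^sub>0 \<in> carr X\<^sub>0 \<and> g\<^sub>1 \<in> carr X\<^sub>1 \<and> g = g\<^sub>0 + g\<^sub>1} \<noteq> {}"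
    using assms(2) by blast
qed (use assms(3) in auto)

lemma K_fun_nonneg:
  assumes "normed_space X\<^sub>0" "normed_space X\<^sub>1" "g \<in> carr X\<^sub>0" "0 \<le> t"
  shows "0 \<le> K_fun X\<^sub>0 X\<^sub>1 g t"
  using assms by (intro K_fun_greatest) (auto intro!: add_nonneg_nonneg mult_nonneg_nonneg normed_spaceD(2))

lemma K_fun_mono_on:
  assumes "normed_space X\<^sub>0" "normed_space X\<^sub>1" "g \<in> carr X\<^sub>0"
  shows "mono_on {0..} (K_fun X\<^sub>0 X\<^sub>1 g)"
proof (rule mono_onI)
  fix s t :: real assume st: "s \<in> {0..}" "t \<in> {0..}" "s \<le> t"
  show "K_fun X\<^sub>0 X\<^sub>1 g s \<le> K_fun X\<^sub>0 X\<^sub>1 g t"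
  proof (rule K_fun_greatest)
    fix g\<^sub>0 g\<^sub>1 assume g: "g\<^sub>0 \<in> carr X\<^sub>0" "g\<^sub>1 \<in> carr X\<^sub>1" "g = g\<^sub>0 + g\<^sub>1"
    have "K_fun X\<^sub>0 X\<^sub>1 g s \<le> nrm X\<^sub>0 g\<^sub>0 + s * nrm X\<^sub>1 g\<^sub>1"
      using K_fun_upper[OF assms(1,2) g(1,2), of s] g st by simp
    also have "\<dots> \<le> nrm X\<^sub>0 g\<^sub>0 + t * nrm X\<^sub>1 g\<^sub>1"
      using st normed_spaceD(2)[OF assms(2) g(2)] by (simp add: mult_right_mono)
    finally show "K_fun X\<^sub>0 X\<^sub>1 g s \<le> nrm X\<^sub>0 g\<^sub>0 + t * nrm X\<^sub>1 g\<^sub>1" .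
  qed fact+
qed

lemma K_fun_diff_le:
  assumes X0: "normed_space X\<^sub>0" and X1: "normed_space X\<^sub>1"
    and a: "a \<in> carr X\<^sub>0" and b: "b \<in> carr X\<^sub>0" and t: "0 \<le> t"
  shows "K_fun X\<^sub>0 X\<^sub>1 (a - b) t \<le> K_fun X\<^sub>0 X\<^sub>1 a t + K_fun X\<^sub>0 X\<^sub>1 b t"
proof -
  have *: "K_fun X\<^sub>0 X\<^sub>1 (a - b) t \<le> (nrm X\<^sub>0 a\<^sub>0 + t * nrm X\<^sub>1 a\<^sub>1) + (nrm X\<^sub>0 b\<^sub>0 + t * nrm X\<^sub>1 b\<^sub>1)"
    if ab: "a\<^sub>0 \<in> carr X\<^sub>0" "a\<^sub>1 \<in> carr X\<^sub>1" "a = a\<^sub>0 + a\<^sub>1" "b\<^sub>0 \<in> carr X\<^sub>0" "b\<^sub>1 \<in> carr X\<^sub>1" "b = b\<^sub>0 + b\<^sub>1"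
    for a\<^sub>0 a\<^sub>1 b\<^sub>0 b\<^sub>1
  proof -
    have "a - b = (a\<^sub>0 - b\<^sub>0) + (a\<^sub>1 - b\<^sub>1)"
      using ab by simp
    moreover have "a\<^sub>0 - b\<^sub>0 \<in> carr X\<^sub>0" "a\<^sub>1 - b\<^sub>1 \<in> carr X\<^sub>1"
      using ab X0 X1 by (auto intro!: subspace_diff normed_spaceD(1))
    ultimately have "K_fun X\<^sub>0 X\<^sub>1 (a - b) t \<le> nrm X\<^sub>0 (a\<^sub>0 - b\<^sub>0) + t * nrm X\<^sub>1 (a\<^sub>1 - b\<^sub>1)"
      using K_fun_upper[OF X0 X1 _ _ t] by metis
    also have "\<dots> \<le> (nrm X\<^sub>0 a\<^sub>0 + nrm X\<^sub>0 b\<^sub>0) + t * (nrm X\<^sub>1 a\<^sub>1 + nrm X\<^sub>1 b\<^sub>1)"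
      using ab X0 X1 t by (intro add_mono mult_left_mono normed_spaceD(4)) auto
    finally show ?thesis
      by (simp add: algebra_simps)
  qed
  have "K_fun X\<^sub>0 X\<^sub>1 (a - b) t - K_fun X\<^sub>0 X\<^sub>1 b t \<le> K_fun X\<^sub>0 X\<^sub>1 a t"
  proof (rule K_fun_greatest[OF X1 a])
    fix a\<^sub>0 a\<^sub>1 assume a01: "a\<^sub>0 \<in> carr X\<^sub>0" "a\<^sub>1 \<in> carr X\<^sub>1" "a = a\<^sub>0 + a\<^sub>1"
    have "K_fun X\<^sub>0 X\<^sub>1 (a - b) t - (nrm X\<^sub>0 a\<^sub>0 + t * nrm X\<^sub>1 a\<^sub>1) \<le> K_fun X\<^sub>0 X\<^sub>1 b t"
    proof (rule K_fun_greatest[OF X1 b])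
      fix b\<^sub>0 b\<^sub>1 assume b01: "b\<^sub>0 \<in> carr X\<^sub>0" "b\<^sub>1 \<in> carr X\<^sub>1" "b = b\<^sub>0 + b\<^sub>1"
      then show "K_fun X\<^sub>0 X\<^sub>1 (a - b) t - (nrm X\<^sub>0 a\<^sub>0 + t * nrm X\<^sub>1 a\<^sub>1) \<le> nrm X\<^sub>0 b\<^sub>0 + t * nrm X\<^sub>1 b\<^sub>1"
        using *[OF a01 b01] by (simp add: algebra_simps)
    qed
    then show "K_fun X\<^sub>0 X\<^sub>1 (a - b) t - K_fun X\<^sub>0 X\<^sub>1 b t \<le> nrm X\<^sub>0 a\<^sub>0 + t * nrm X\<^sub>1 a\<^sub>1"
      by simp
  qed
  then show ?thesis
    by simp
qed

section \<open>Transport of the K-functional\<close>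

text \<open>
  The approximant \<open>c\<close> of \<open>b\<close> lies in \<open>X\<^sub>1\<close>, hence so does \<open>c + g\<^sub>1\<close>, and
  \<open>\<T> (c + g\<^sub>1) - \<T> c\<close> is an admissible second component. The first component is what remains,
  \<open>(\<T> a - \<T> (c + g\<^sub>1)) - (\<T> b - \<T> c)\<close>; its arguments differ in \<open>X\<^sub>0\<close> by at most the norm of
  \<open>g\<^sub>0\<close> plus \<open>e\<close> and by at most \<open>e\<close>, where \<open>e\<close> is the quality of the approximation.
\<close>

lemma K_fun_holder_split:
  assumes X0: "normed_space X\<^sub>0" and X1: "normed_space X\<^sub>1"
    and Y0: "normed_space Y\<^sub>0" and Y1: "normed_space Y\<^sub>1"
    and sub: "carr X\<^sub>1 \<subseteq> carr X\<^sub>0"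
    and dense: "(norm_topology X\<^sub>0) closure_of (carr X\<^sub>1) = carr X\<^sub>0"
    and al: "0 < \<alpha>" and M: "0 < M" and t: "0 < t"
    and T0: "\<And>x y. x \<in> carr X\<^sub>0 \<Longrightarrow> y \<in> carr X\<^sub>0 \<Longrightarrow>
               T x - T y \<in> carr Y\<^sub>0 \<and> nrm Y\<^sub>0 (T x - T y) \<le> M * nrm X\<^sub>0 (x - y) powr \<alpha>"
    and T1: "\<And>x y. x \<in> carr X\<^sub>1 \<Longrightarrow> y \<in> carr X\<^sub>1 \<Longrightarrow>
               T x - T y \<in> carr Y\<^sub>1 \<and> nrm Y\<^sub>1 (T x - T y) \<le> M * nrm X\<^sub>1 (x - y) powr \<alpha>"
    and ab: "a \<in> carr X\<^sub>0" "b \<in> carr X\<^sub>0"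
    and g: "g\<^sub>0 \<in> carr X\<^sub>0" "g\<^sub>1 \<in> carr X\<^sub>1" "a - b = g\<^sub>0 + g\<^sub>1"
  shows "K_fun Y\<^sub>0 Y\<^sub>1 (T a - T b) (t powr \<alpha>) \<le> M * nrm X\<^sub>0 g\<^sub>0 powr \<alpha> + M * (t * nrm X\<^sub>1 g\<^sub>1) powr \<alpha>"
proof -
  interpret m: Metric_space "carr X\<^sub>0" "ndist X\<^sub>0"
    by (rule Metric_space_ndist[OF X0])
  note s0 = normed_spaceD(1)[OF X0] and s1 = normed_spaceD(1)[OF X1]
  let ?K = "K_fun Y\<^sub>0 Y\<^sub>1 (T a - T b) (t powr \<alpha>)"
  have bound: "?K \<le> M * (nrm X\<^sub>0 g\<^sub>0 + e) powr \<alpha> + M * e powr \<alpha> + M * (t * nrm X\<^sub>1 g\<^sub>1) powr \<alpha>"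
    if e: "0 < e" for e
  proof -
    have "b \<in> m.mtopology closure_of carr X\<^sub>1"
      using dense ab by (simp add: norm_topology_def)
    then obtain c where c: "c \<in> carr X\<^sub>1" "c \<in> m.mball b e"
      using e unfolding m.metric_closure_of by blast
    then have c0: "c \<in> carr X\<^sub>0" and bc: "nrm X\<^sub>0 (b - c) < e"
      using ab by (auto simp: m.mball_def ndist_def)
    have d1: "c + g\<^sub>1 \<in> carr X\<^sub>1" and d0: "c + g\<^sub>1 \<in> carr X\<^sub>0"
      using c g sub subspace_add[OF s1] by auto
    let ?h0 = "(T a - T (c + g\<^sub>1)) - (T b - T c)" and ?h1 = "T (c + g\<^sub>1) - T c"
    have "?K \<le> nrm Y\<^sub>0 ?h0 + t powr \<alpha> * nrm Y\<^sub>1 ?h1"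
    proof -
      have "?h0 \<in> carr Y\<^sub>0"
        using T0[OF ab(1) d0] T0[OF ab(2) c0] by (auto intro: subspace_diff normed_spaceD(1)[OF Y0])
      moreover have "?h1 \<in> carr Y\<^sub>1"
        using T1[OF d1 c(1)] by simp
      ultimately have "K_fun Y\<^sub>0 Y\<^sub>1 (?h0 + ?h1) (t powr \<alpha>) \<le> nrm Y\<^sub>0 ?h0 + t powr \<alpha> * nrm Y\<^sub>1 ?h1"
        by (rule K_fun_upper[OF Y0 Y1]) simp
      then show ?thesis by simp
    qed
    moreover have "nrm Y\<^sub>0 ?h0 \<le> nrm Y\<^sub>0 (T a - T (c + g\<^sub>1)) + nrm Y\<^sub>0 (T b - T c)"
      using T0[OF ab(1) d0] T0[OF ab(2) c0] by (intro normed_spaceD(4)[OF Y0]) auto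
    moreover have "nrm Y\<^sub>0 (T a - T (c + g\<^sub>1)) \<le> M * (nrm X\<^sub>0 g\<^sub>0 + e) powr \<alpha>"
    proof -
      have eq: "a - (c + g\<^sub>1) = g\<^sub>0 + (b - c)"
        using g(3) by (simp add: algebra_simps)
      have "nrm X\<^sub>0 (a - (c + g\<^sub>1)) \<le> nrm X\<^sub>0 g\<^sub>0 + e"
        unfolding eq using normed_spaceD(3)[OF X0 g(1) subspace_diff[OF s0 ab(2) c0]] bc by simp
      moreover have "0 \<le> nrm X\<^sub>0 (a - (c + g\<^sub>1))"
        using ab d0 by (intro normed_spaceD(2)[OF X0] subspace_diff[OF s0])
      ultimately have "M * nrm X\<^sub>0 (a - (c + g\<^sub>1)) powr \<alpha> \<le> M * (nrm X\<^sub>0 g\<^sub>0 + e) powr \<alpha>"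
        using al M by (intro mult_left_mono powr_mono2) auto
      then show ?thesis
        using T0[OF ab(1) d0] by linarith
    qed
    moreover have "nrm Y\<^sub>0 (T b - T c) \<le> M * e powr \<alpha>"
    proof -
      have "M * nrm X\<^sub>0 (b - c) powr \<alpha> \<le> M * e powr \<alpha>"
        using al M bc normed_spaceD(2)[OF X0 subspace_diff[OF s0 ab(2) c0]]
        by (intro mult_left_mono powr_mono2) auto
      then show ?thesis
        using T0[OF ab(2) c0] by linarith
    qed
    moreover have "t powr \<alpha> * nrm Y\<^sub>1 ?h1 \<le> M * (t * nrm X\<^sub>1 g\<^sub>1) powr \<alpha>"
    proof -
      have "t powr \<alpha> * nrm Y\<^sub>1 ?h1 \<le> t powr \<alpha> * (M * nrm X\<^sub>1 g\<^sub>1 powr \<alpha>)"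
        using T1[OF d1 c(1)] by (intro mult_left_mono) auto
      also have "\<dots> = M * (t * nrm X\<^sub>1 g\<^sub>1) powr \<alpha>"
        by (simp add: powr_mult)
      finally show ?thesis .
    qed
    ultimately show ?thesis
      by linarith
  qed
  have "((\<lambda>e. (nrm X\<^sub>0 g\<^sub>0 + e) powr \<alpha>) \<longlongrightarrow> (nrm X\<^sub>0 g\<^sub>0 + 0) powr \<alpha>) (at_right 0)"
    using normed_spaceD(2)[OF X0 g(1)] al
    by (intro tendsto_powr2 tendsto_add tendsto_const tendsto_ident_at) (auto simp: eventually_at_filter)
  moreover have "((\<lambda>e::real. e powr \<alpha>) \<longlongrightarrow> 0 powr \<alpha>) (at_right 0)"
    using al by (intro tendsto_powr2 tendsto_const tendsto_ident_at) (auto simp: eventually_at_filter)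
  ultimately have "((\<lambda>e. M * (nrm X\<^sub>0 g\<^sub>0 + e) powr \<alpha> + M * e powr \<alpha> + M * (t * nrm X\<^sub>1 g\<^sub>1) powr \<alpha>) \<longlongrightarrow>
      M * (nrm X\<^sub>0 g\<^sub>0 + 0) powr \<alpha> + M * 0 powr \<alpha> + M * (t * nrm X\<^sub>1 g\<^sub>1) powr \<alpha>) (at_right 0)"
    by (intro tendsto_add tendsto_mult tendsto_const)
  moreover have "\<forall>\<^sub>F e in at_right 0.
      ?K \<le> M * (nrm X\<^sub>0 g\<^sub>0 + e) powr \<alpha> + M * e powr \<alpha> + M * (t * nrm X\<^sub>1 g\<^sub>1) powr \<alpha>"
    using bound by (auto simp: eventually_at_filter)
  ultimately show ?thesis
    using al tendsto_lowerbound[of _ _ "at_right (0::real)" ?K] by fastforce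
qed

text \<open>
  The bound for one splitting passes to the infimum over all splittings once it is solved for the
  norm of the splitting, that is, raised to the power \<open>1/\<alpha>\<close>. The factor 2 comes from
  \<open>x\<^sup>\<alpha> + y\<^sup>\<alpha> \<le> 2 (x + y)\<^sup>\<alpha>\<close>.
\<close>

lemma K_fun_holder:
  assumes X0: "normed_space X\<^sub>0" and X1: "normed_space X\<^sub>1"
    and Y0: "normed_space Y\<^sub>0" and Y1: "normed_space Y\<^sub>1"
    and sub: "carr X\<^sub>1 \<subseteq> carr X\<^sub>0"
    and dense: "(norm_topology X\<^sub>0) closure_of (carr X\<^sub>1) = carr X\<^sub>0"
    and al: "0 < \<alpha>"
    and H0: "holderian \<alpha> X\<^sub>0 Y\<^sub>0 T" and H1: "holderian \<alpha> X\<^sub>1 Y\<^sub>1 T"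
  obtains C where "0 < C"
    and "\<And>a b t. \<lbrakk>a \<in> carr X\<^sub>0; b \<in> carr X\<^sub>0; 0 < t\<rbrakk> \<Longrightarrow>
           K_fun Y\<^sub>0 Y\<^sub>1 (T a - T b) (t powr \<alpha>) \<le> C * K_fun X\<^sub>0 X\<^sub>1 (a - b) t powr \<alpha>"
proof -
  from H0 obtain M0 where M0: "M0 > 0"
    "\<And>x y. x \<in> carr X\<^sub>0 \<Longrightarrow> y \<in> carr X\<^sub>0 \<Longrightarrow>
       T x - T y \<in> carr Y\<^sub>0 \<and> nrm Y\<^sub>0 (T x - T y) \<le> M0 * nrm X\<^sub>0 (x - y) powr \<alpha>"
    unfolding holderian_def by blast
  from H1 obtain M1 where M1: "M1 > 0"
    "\<And>x y. x \<in> carr X\<^sub>1 \<Longrightarrow> y \<in> carr X\<^sub>1 \<Longrightarrow>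
       T x - T y \<in> carr Y\<^sub>1 \<and> nrm Y\<^sub>1 (T x - T y) \<le> M1 * nrm X\<^sub>1 (x - y) powr \<alpha>"
    unfolding holderian_def by blast
  define M where "M = max M0 M1"
  have M: "M > 0" "M0 * z powr \<alpha> \<le> M * z powr \<alpha>" "M1 * z powr \<alpha> \<le> M * z powr \<alpha>" for z
    using M0(1) by (auto simp: M_def intro!: mult_right_mono)
  show thesis
  proof (rule that)
    show "0 < 2 * M"
      using M by simp
    fix a b t assume ab: "a \<in> carr X\<^sub>0" "b \<in> carr X\<^sub>0" and t: "0 < (t::real)"
    let ?K = "K_fun Y\<^sub>0 Y\<^sub>1 (T a - T b) (t powr \<alpha>)"
    have K0: "0 \<le> ?K"
      using M0(2)[OF ab] by (intro K_fun_nonneg[OF Y0 Y1]) auto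
    have "(?K / (2 * M)) powr (1 / \<alpha>) \<le> K_fun X\<^sub>0 X\<^sub>1 (a - b) t"
    proof (rule K_fun_greatest[OF X1])
      show "a - b \<in> carr X\<^sub>0"
        using ab by (rule subspace_diff[OF normed_spaceD(1)[OF X0]])
      fix g\<^sub>0 g\<^sub>1 assume g: "g\<^sub>0 \<in> carr X\<^sub>0" "g\<^sub>1 \<in> carr X\<^sub>1" "a - b = g\<^sub>0 + g\<^sub>1"
      let ?n = "nrm X\<^sub>0 g\<^sub>0 + t * nrm X\<^sub>1 g\<^sub>1"
      have pos: "0 \<le> nrm X\<^sub>0 g\<^sub>0" "0 \<le> t * nrm X\<^sub>1 g\<^sub>1"
        using g t normed_spaceD(2)[OF X0] normed_spaceD(2)[OF X1] by auto
      have "?K \<le> M * nrm X\<^sub>0 g\<^sub>0 powr \<alpha> + M * (t * nrm X\<^sub>1 g\<^sub>1) powr \<alpha>"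
        by (rule K_fun_holder_split[OF X0 X1 Y0 Y1 sub dense al M(1) t _ _ ab g])
          (use M0(2) M1(2) M(2,3) in \<open>meson order_trans\<close>)+
      also have "\<dots> \<le> M * ?n powr \<alpha> + M * ?n powr \<alpha>"
        using pos M(1) al by (intro add_mono mult_left_mono powr_mono2) auto
      finally have "?K / (2 * M) \<le> ?n powr \<alpha>"
        using M(1) by (simp add: field_simps)
      then have "(?K / (2 * M)) powr (1 / \<alpha>) \<le> (?n powr \<alpha>) powr (1 / \<alpha>)"
        using K0 M(1) al by (intro powr_mono2) auto
      also have "\<dots> = ?n"
        using al pos by (simp add: powr_powr)
      finally show "(?K / (2 * M)) powr (1 / \<alpha>) \<le> ?n" .
    qed
    then have "((?K / (2 * M)) powr (1 / \<alpha>)) powr \<alpha> \<le> K_fun X\<^sub>0 X\<^sub>1 (a - b) t powr \<alpha>"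
      using al by (intro powr_mono2) auto
    moreover have "((?K / (2 * M)) powr (1 / \<alpha>)) powr \<alpha> = ?K / (2 * M)"
      using al K0 M(1) by (simp add: powr_powr)
    ultimately have "?K / (2 * M) \<le> K_fun X\<^sub>0 X\<^sub>1 (a - b) t powr \<alpha>"
      by simp
    then show "?K \<le> 2 * M * K_fun X\<^sub>0 X\<^sub>1 (a - b) t powr \<alpha>"
      using M(1) by (simp add: field_simps)
  qed
qed

section \<open>The Lebesgue norms on the unit interval\<close>

lemma Lq_norm01_ennreal:
  assumes "0 < P"
  shows "Lq_norm01 (ennreal P) f =
    (let I = (\<integral>\<^sup>+ t. ennreal (\<bar>f t\<bar> powr P) \<partial>lebesgue_on {0<..<1})
     in if I = \<infinity> then \<infinity> else ennreal (enn2real I powr (1 / P)))"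
  using assms by (simp add: Lq_norm01_def Let_def)

lemma borel_measurable_lebesgue_onI:
  fixes f :: "real \<Rightarrow> real"
  assumes "f \<in> borel_measurable (restrict_space borel S)"
  shows "f \<in> borel_measurable (lebesgue_on S)"
proof -
  have "sets (restrict_space borel S) \<subseteq> sets (lebesgue_on S)"
    by (auto simp: sets_restrict_space)
  then show ?thesis
    using assms measurable_mono[of borel borel "restrict_space borel S" "lebesgue_on S"]
    by (auto simp: space_restrict_space)
qed

lemma powr_image_unit_interval:
  assumes "0 < (\<alpha>::real)"
  shows "(\<lambda>t. t powr \<alpha>) ` {0<..<1} = {0<..<1}"
proof -
  have "t powr \<alpha> \<in> {0<..<1}" if "t \<in> {0<..<1}" "0 < \<alpha>" for t \<alpha> :: real
    using that powr_less_mono2[of \<alpha> t 1] by auto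
  moreover have "s = (s powr (1 / \<alpha>)) powr \<alpha>" if "s \<in> {0<..<1}" for s :: real
    using that assms by (simp add: powr_powr)
  ultimately show ?thesis
    using assms by (auto intro!: image_eqI[of s _ "s powr (1 / \<alpha>)" for s])
qed

text \<open>
  The derivative of \<open>t\<^sup>\<alpha>\<close> may be unbounded near 0, so the substitution rules on compact intervals do
  not apply directly. The change of variables for absolutely integrable functions covers the
  open interval, and finiteness of the right-hand side supplies the integrability.
\<close>

lemma nn_integral_powr_substitution:
  fixes F :: "real \<Rightarrow> real"
  assumes al: "0 < \<alpha>"
    and meas: "F \<in> borel_measurable (restrict_space borel {0<..<1})"
    and nonneg: "\<And>s. s \<in> {0<..<1} \<Longrightarrow> 0 \<le> F s"
    and fin: "(\<integral>\<^sup>+ t. ennreal (\<alpha> * t powr (\<alpha> - 1) * F (t powr \<alpha>)) \<partial>lebesgue_on {0<..<1}) < \<infinity>"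
  shows "(\<integral>\<^sup>+ s. ennreal (F s) \<partial>lebesgue_on {0<..<1}) =
    (\<integral>\<^sup>+ t. ennreal (\<alpha> * t powr (\<alpha> - 1) * F (t powr \<alpha>)) \<partial>lebesgue_on {0<..<1})"
proof -
  let ?S = "{0<..<1::real}" and ?G = "\<lambda>t. \<alpha> * t powr (\<alpha> - 1) * F (t powr \<alpha>)"
  have img: "(\<lambda>t. t powr \<alpha>) ` ?S = ?S"
    by (rule powr_image_unit_interval[OF al])
  have S: "?S \<in> sets lebesgue"
    by simp
  have nonnegG: "0 \<le> ?G t" if "t \<in> ?S" for t
  proof -
    have "t powr \<alpha> \<in> ?S"
      using that img by blast
    then show ?thesis
      using nonneg al by simp
  qed
  have [measurable]: "(\<lambda>t::real. t) \<in> borel_measurable (restrict_space borel ?S)"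
    by (rule measurable_restrict_space1) simp
  have "(\<lambda>t. t powr \<alpha>) \<in> borel_measurable (restrict_space borel ?S)"
    by measurable
  then have "(\<lambda>t. t powr \<alpha>) \<in> measurable (restrict_space borel ?S) (restrict_space borel ?S)"
    using img by (intro measurable_restrict_space2) (auto simp: space_restrict_space)
  from measurable_compose[OF this meas]
  have "?G \<in> borel_measurable (restrict_space borel ?S)"
    by measurable
  then have measG: "?G \<in> borel_measurable (lebesgue_on ?S)"
    by (rule borel_measurable_lebesgue_onI)
  have aeG: "AE t in lebesgue_on ?S. 0 \<le> ?G t"
    using nonnegG by (intro AE_I2) (auto simp: space_restrict_space)
  have intG: "integrable (lebesgue_on ?S) ?G"
    using measG aeG fin by (intro integrableI_nonneg) auto
  have absG: "?G absolutely_integrable_on ?S"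
    using intG integrable_restrict_space[of ?S lebesgue ?G] by (simp add: set_integrable_def)
  define b where "b = integral ?S ?G"
  have GG: "\<bar>\<alpha> * t powr (\<alpha> - 1)\<bar> * F (t powr \<alpha>) = ?G t" for t
    using al by simp
  have "((\<lambda>t. \<bar>\<alpha> * t powr (\<alpha> - 1)\<bar> * F (t powr \<alpha>)) absolutely_integrable_on ?S \<and>
          integral ?S (\<lambda>t. \<bar>\<alpha> * t powr (\<alpha> - 1)\<bar> * F (t powr \<alpha>)) = b) \<longleftrightarrow>
        (F absolutely_integrable_on (\<lambda>t. t powr \<alpha>) ` ?S \<and> integral ((\<lambda>t. t powr \<alpha>) ` ?S) F = b)"
  proof (rule has_absolute_integral_change_of_variables_1'[OF S])
    show "((\<lambda>t. t powr \<alpha>) has_field_derivative \<alpha> * t powr (\<alpha> - 1)) (at t within ?S)"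
      if "t \<in> ?S" for t
      using that by (auto intro: has_field_derivative_at_within has_real_derivative_powr)
    show "inj_on (\<lambda>t. t powr \<alpha>) ?S"
      using al by (intro inj_on_inverseI[of _ "\<lambda>s. s powr (1 / \<alpha>)"]) (auto simp: powr_powr)
  qed
  then have absF: "F absolutely_integrable_on ?S" and intFb: "integral ?S F = b"
    unfolding GG img using absG b_def by auto
  have intF: "integrable (lebesgue_on ?S) F"
    by (rule absolutely_integrable_imp_integrable[OF absF S])
  have "(\<integral>\<^sup>+ s. ennreal (F s) \<partial>lebesgue_on ?S) = ennreal (integral\<^sup>L (lebesgue_on ?S) F)"
    using nonneg by (intro nn_integral_eq_integral[OF intF] AE_I2) (auto simp: space_restrict_space)
  also have "\<dots> = ennreal (integral\<^sup>L (lebesgue_on ?S) ?G)"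
    using lebesgue_integral_eq_integral[OF intF S] lebesgue_integral_eq_integral[OF intG S] intFb
    by (simp add: b_def)
  also have "\<dots> = (\<integral>\<^sup>+ t. ennreal (?G t) \<partial>lebesgue_on ?S)"
    by (rule nn_integral_eq_integral[OF intG aeG, symmetric])
  finally show ?thesis .
qed

text \<open>The exceptional set of \<open>Q\<close> is the image of that of the hypothesis under a differentiable map, and
  such maps preserve null sets.\<close>

lemma AE_powr_substitution:
  assumes al: "0 < \<alpha>" and ae: "AE t in lebesgue_on {0<..<1::real}. Q (t powr \<alpha>)"
  shows "AE s in lebesgue_on {0<..<1}. Q s"
proof -
  let ?S = "{0<..<1::real}"
  have iff: "(AE x in lebesgue_on ?S. R x) \<longleftrightarrow> negligible {x \<in> ?S. \<not> R x}" for R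
    by (simp add: AE_restrict_space_iff negligible_iff_null_sets AE_iff_null_sets completion.AE_iff_null_sets)
  let ?N = "{t \<in> ?S. \<not> Q (t powr \<alpha>)}"
  have "negligible ((\<lambda>t. t powr \<alpha>) ` ?N)"
  proof (rule negligible_differentiable_image_negligible)
    show "negligible ?N"
      using ae unfolding iff .
    show "(\<lambda>t. t powr \<alpha>) differentiable_on ?N"
      unfolding differentiable_on_def
      by (auto intro!: differentiable_at_withinI
          differentiableI[OF has_field_derivative_imp_has_derivative[OF has_real_derivative_powr]])
  qed simp
  moreover have "{s \<in> ?S. \<not> Q s} \<subseteq> (\<lambda>t. t powr \<alpha>) ` ?N"
  proof
    fix s assume s: "s \<in> {s \<in> ?S. \<not> Q s}"
    then have "s \<in> (\<lambda>t. t powr \<alpha>) ` ?S"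
      using powr_image_unit_interval[OF al] by simp
    then show "s \<in> (\<lambda>t. t powr \<alpha>) ` ?N"
      using s by auto
  qed
  ultimately show ?thesis
    unfolding iff by (rule negligible_subset)
qed

text \<open>
  For \<open>p < \<infinity>\<close> and \<open>q = p/\<alpha>\<close> the power of \<open>t\<close> in the pointwise hypothesis, raised to \<open>q\<close>, is
  \<open>t\<^sup>1\<^sup>-\<^sup>\<alpha>\<close>, which cancels the derivative of the substitution. What remains is
  \<open>\<alpha> B\<^sup>q\<close> times the integral of \<open>u\<^sup>p\<close>, and \<open>\<alpha> \<le> 1\<close> lets the constant \<open>B\<close> serve all \<open>p\<close>. For
  \<open>p = \<infinity>\<close> the power of \<open>t\<close> has exponent 0.
\<close>

lemma Lq_norm01_holder_substitution:
  fixes u v :: "real \<Rightarrow> real"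
  assumes al: "0 < \<alpha>" "\<alpha> \<le> 1" and p: "1 \<le> p" and B: "0 \<le> B"
    and mu: "u \<in> borel_measurable (restrict_space borel {0<..<1})"
    and mv: "v \<in> borel_measurable (restrict_space borel {0<..<1})"
    and u0: "\<And>t. t \<in> {0<..<1} \<Longrightarrow> 0 \<le> u t"
    and v0: "\<And>t. t \<in> {0<..<1} \<Longrightarrow> 0 \<le> v t"
    and le: "\<And>t. t \<in> {0<..<1} \<Longrightarrow>
               v (t powr \<alpha>) \<le> B * t powr (\<alpha> * enn2real (1 / p) * (1 - \<alpha>)) * u t powr \<alpha>"
    and fin: "Lq_norm01 p u < \<infinity>"
  shows "Lq_norm01 (p / ennreal \<alpha>) v \<le> ennreal (B * enn2real (Lq_norm01 p u) powr \<alpha>)"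
proof (cases "p = \<infinity>")
  case True
  let ?L = "lebesgue_on {0<..<1::real}"
  define S where "S = esssup ?L (\<lambda>t. ennreal \<bar>u t\<bar>)"
  have S: "Lq_norm01 p u = S" "S < \<infinity>"
    using True fin by (auto simp: Lq_norm01_def S_def)
  have "AE t in ?L. ennreal \<bar>u t\<bar> \<le> S"
    unfolding S_def by (rule esssup_AE)
  then have "AE t in ?L. v (t powr \<alpha>) \<le> B * enn2real S powr \<alpha>"
  proof (rule AE_mp, intro AE_I2 impI)
    fix t assume t: "t \<in> space ?L" "ennreal \<bar>u t\<bar> \<le> S"
    then have t01: "t \<in> {0<..<1}"
      by (auto simp: space_restrict_space)
    have "u t \<le> enn2real S"
      using t(2) S(2) enn2real_mono[of "ennreal \<bar>u t\<bar>" S] by auto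
    then have "u t powr \<alpha> \<le> enn2real S powr \<alpha>"
      using u0[OF t01] al by (intro powr_mono2) auto
    then have "B * u t powr \<alpha> \<le> B * enn2real S powr \<alpha>"
      using B by (rule mult_left_mono)
    then show "v (t powr \<alpha>) \<le> B * enn2real S powr \<alpha>"
      using le[OF t01] t01 True by simp
  qed
  then have ae: "AE s in ?L. v s \<le> B * enn2real S powr \<alpha>"
    by (rule AE_powr_substitution[OF al(1)])
  have "esssup ?L (\<lambda>t. ennreal \<bar>v t\<bar>) \<le> ennreal (B * enn2real S powr \<alpha>)"
  proof (rule esssup_I)
    show "(\<lambda>t. ennreal \<bar>v t\<bar>) \<in> borel_measurable ?L"
      using borel_measurable_lebesgue_onI[OF mv] by measurable
    show "AE s in ?L. ennreal \<bar>v s\<bar> \<le> ennreal (B * enn2real S powr \<alpha>)"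
      using ae by (rule AE_mp, intro AE_I2) (auto simp: space_restrict_space v0 intro!: ennreal_leI)
  qed
  then show ?thesis
    using True S al by (simp add: Lq_norm01_def ennreal_top_divide)
next
  case False
  let ?L = "lebesgue_on {0<..<1::real}"
  obtain P where P: "p = ennreal P" "1 \<le> P"
    using False p by (cases p) auto
  define q where "q = P / \<alpha>"
  have q: "0 < q" "p / ennreal \<alpha> = ennreal q" "q * \<alpha> = P"
    using P al by (auto simp: q_def divide_ennreal)
  have r: "enn2real (1 / p) = 1 / P"
    using P divide_ennreal[of 1 P] by (simp add: ennreal_1[symmetric] del: ennreal_1)
  let ?V = "\<lambda>s. \<bar>v s\<bar> powr q"
  define I where "I = (\<integral>\<^sup>+ t. ennreal (\<bar>u t\<bar> powr P) \<partial>?L)"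
  have I: "I < \<infinity>" "Lq_norm01 p u = ennreal (enn2real I powr (1 / P))"
    using fin P by (auto simp: Lq_norm01_ennreal I_def Let_def less_top split: if_splits)
  define J where "J = (\<integral>\<^sup>+ s. ennreal (?V s) \<partial>?L)"
  have pw: "\<alpha> * t powr (\<alpha> - 1) * ?V (t powr \<alpha>) \<le> B powr q * \<bar>u t\<bar> powr P" if t: "t \<in> {0<..<1}" for t
  proof -
    have "t powr \<alpha> \<in> {0<..<1}"
      using powr_image_unit_interval[OF al(1)] t by blast
    then have "?V (t powr \<alpha>) \<le> (B * t powr (\<alpha> * (1 / P) * (1 - \<alpha>)) * u t powr \<alpha>) powr q"
      using v0 le[OF t] q r by (intro powr_mono2) auto
    also have "\<dots> = B powr q * t powr (1 - \<alpha>) * u t powr P"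
    proof -
      have "\<alpha> * (1 / P) * (1 - \<alpha>) * q = 1 - \<alpha>" "\<alpha> * q = P"
        using P al by (auto simp: q_def)
      then show ?thesis
        by (simp only: powr_mult powr_powr)
    qed
    finally have "\<alpha> * t powr (\<alpha> - 1) * ?V (t powr \<alpha>) \<le>
        \<alpha> * t powr (\<alpha> - 1) * (B powr q * t powr (1 - \<alpha>) * u t powr P)"
      using al by (intro mult_left_mono) auto
    also have "\<dots> = \<alpha> * (t powr (\<alpha> - 1) * t powr (1 - \<alpha>)) * (B powr q * u t powr P)"
      by simp
    also have "t powr (\<alpha> - 1) * t powr (1 - \<alpha>) = 1"
      using t by (simp add: powr_add[symmetric])
    also have "\<alpha> * 1 * (B powr q * u t powr P) \<le> B powr q * u t powr P"
      using al by (simp add: mult_left_le_one_le)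
    finally show ?thesis
      using u0[OF t] by simp
  qed
  have mu': "(\<lambda>t. ennreal (\<bar>u t\<bar> powr P)) \<in> borel_measurable ?L"
    using borel_measurable_lebesgue_onI[OF mu] by measurable
  have "(\<integral>\<^sup>+ t. ennreal (\<alpha> * t powr (\<alpha> - 1) * ?V (t powr \<alpha>)) \<partial>?L) \<le>
      (\<integral>\<^sup>+ t. ennreal (B powr q) * ennreal (\<bar>u t\<bar> powr P) \<partial>?L)"
    using pw by (intro nn_integral_mono) (auto simp: space_restrict_space ennreal_mult[symmetric] intro!: ennreal_leI)
  also have "\<dots> = ennreal (B powr q) * I"
    unfolding I_def by (rule nn_integral_cmult[OF mu'])
  finally have le1: "(\<integral>\<^sup>+ t. ennreal (\<alpha> * t powr (\<alpha> - 1) * ?V (t powr \<alpha>)) \<partial>?L) \<le> ennreal (B powr q) * I" .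
  have finB: "ennreal (B powr q) * I < \<infinity>"
    using I by (simp add: ennreal_mult_less_top)
  have "J = (\<integral>\<^sup>+ t. ennreal (\<alpha> * t powr (\<alpha> - 1) * ?V (t powr \<alpha>)) \<partial>?L)"
    unfolding J_def
  proof (rule nn_integral_powr_substitution[OF al(1)])
    show "?V \<in> borel_measurable (restrict_space borel {0<..<1})"
      using mv by measurable
  qed (use le1 finB in auto)
  then have J: "J \<le> ennreal (B powr q) * I" "J < \<infinity>"
    using le1 finB by auto
  have "enn2real J \<le> B powr q * enn2real I"
    using enn2real_mono[OF J(1)] finB by (simp add: enn2real_mult)
  then have "enn2real J powr (1 / q) \<le> (B powr q * enn2real I) powr (1 / q)"
    using q by (intro powr_mono2) auto
  also have "\<dots> = B * (enn2real I powr (1 / P)) powr \<alpha>"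
    using q B P by (simp add: powr_mult powr_powr q_def)
  finally have "ennreal (enn2real J powr (1 / q)) \<le> ennreal (B * (enn2real I powr (1 / P)) powr \<alpha>)"
    by (rule ennreal_leI)
  then show ?thesis
    using less_imp_neq[OF J(2)] I q by (simp add: Lq_norm01_ennreal J_def[symmetric])
qed

text \<open>Only finiteness is claimed, so instead of the Minkowski inequality the elementary bound
  \<open>(x + y)\<^sup>p \<le> 2\<^sup>p (x\<^sup>p + y\<^sup>p)\<close> suffices.\<close>

lemma Lq_norm01_finite_add:
  fixes u v w :: "real \<Rightarrow> real"
  assumes p: "1 \<le> p"
    and mu: "u \<in> borel_measurable (restrict_space borel {0<..<1})"
    and mv: "v \<in> borel_measurable (restrict_space borel {0<..<1})"
    and mw: "w \<in> borel_measurable (restrict_space borel {0<..<1})"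
    and le: "\<And>t. t \<in> {0<..<1} \<Longrightarrow> \<bar>w t\<bar> \<le> \<bar>u t\<bar> + \<bar>v t\<bar>"
    and fin: "Lq_norm01 p u < \<infinity>" "Lq_norm01 p v < \<infinity>"
  shows "Lq_norm01 p w < \<infinity>"
proof (cases "p = \<infinity>")
  case True
  let ?L = "lebesgue_on {0<..<1::real}"
  let ?E = "\<lambda>f. esssup ?L (\<lambda>t. ennreal \<bar>f t\<bar>)"
  have "?E w \<le> ?E u + ?E v"
  proof (rule esssup_I)
    show "(\<lambda>t. ennreal \<bar>w t\<bar>) \<in> borel_measurable ?L"
      using borel_measurable_lebesgue_onI[OF mw] by measurable
    have "AE t in ?L. t \<in> {0<..<1}" "AE t in ?L. ennreal \<bar>u t\<bar> \<le> ?E u" "AE t in ?L. ennreal \<bar>v t\<bar> \<le> ?E v"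
      by (rule AE_I2, simp add: space_restrict_space) (rule esssup_AE)+
    then show "AE t in ?L. ennreal \<bar>w t\<bar> \<le> ?E u + ?E v"
    proof eventually_elim
      case (elim t)
      have "ennreal \<bar>w t\<bar> \<le> ennreal \<bar>u t\<bar> + ennreal \<bar>v t\<bar>"
        using ennreal_leI[OF le[OF elim(1)]] by simp
      also have "\<dots> \<le> ?E u + ?E v"
        using elim(2,3) by (rule add_mono)
      finally show ?case .
    qed
  qed
  then show ?thesis
    using True fin by (auto simp: Lq_norm01_def intro: le_less_trans)
next
  case False
  let ?L = "lebesgue_on {0<..<1::real}"
  obtain P where P: "p = ennreal P" "1 \<le> P"
    using False p by (cases p) auto
  let ?I = "\<lambda>f. \<integral>\<^sup>+ t. ennreal (\<bar>f t\<bar> powr P) \<partial>?L"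
  have fin_iff: "Lq_norm01 p f < \<infinity> \<longleftrightarrow> ?I f < \<infinity>" for f
    using P by (simp add: Lq_norm01_ennreal Let_def less_top)
  have [measurable]: "u \<in> borel_measurable ?L" "v \<in> borel_measurable ?L"
    using mu mv by (auto intro: borel_measurable_lebesgue_onI)
  have pw: "ennreal (\<bar>w t\<bar> powr P) \<le>
      ennreal (2 powr P) * (ennreal (\<bar>u t\<bar> powr P) + ennreal (\<bar>v t\<bar> powr P))" if t: "t \<in> {0<..<1}" for t
  proof -
    have "\<bar>w t\<bar> powr P \<le> (2 * max \<bar>u t\<bar> \<bar>v t\<bar>) powr P"
      using le[OF t] P by (intro powr_mono2) auto
    also have "\<dots> = 2 powr P * max \<bar>u t\<bar> \<bar>v t\<bar> powr P"
      by (rule powr_mult)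
    also have "\<dots> \<le> 2 powr P * (\<bar>u t\<bar> powr P + \<bar>v t\<bar> powr P)"
      by (intro mult_left_mono) (auto simp: max_def)
    finally show ?thesis
      by (simp add: ennreal_mult[symmetric] ennreal_plus[symmetric] del: ennreal_plus)
  qed
  have "?I w \<le> (\<integral>\<^sup>+ t. ennreal (2 powr P) * (ennreal (\<bar>u t\<bar> powr P) + ennreal (\<bar>v t\<bar> powr P)) \<partial>?L)"
    using pw by (intro nn_integral_mono) (auto simp: space_restrict_space)
  also have "\<dots> = ennreal (2 powr P) * (?I u + ?I v)"
    by (subst nn_integral_cmult, measurable, subst nn_integral_add, measurable)
  also have "\<dots> < \<infinity>"
    using fin[unfolded fin_iff] by (simp add: ennreal_mult_less_top)
  finally show ?thesis
    unfolding fin_iff .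
qed

section \<open>Interpolation spaces\<close>

text \<open>
  The base satisfies \<open>\<alpha> (1 - ln t) \<le> 1 - \<alpha> ln t \<le> 1 - ln t\<close>. The upper bound is used for
  \<open>lam \<ge> 0\<close>, where it gives the constant 1, and the lower bound for \<open>lam < 0\<close>, where the constant is
  \<open>\<alpha>\<close> to the power \<open>lam\<close>; the stated constant is good for both signs.
\<close>

lemma log_weight_dilation:
  fixes \<alpha> lam t :: real
  assumes "0 < \<alpha>" "\<alpha> \<le> 1" "0 < t" "t < 1"
  shows "(1 - \<alpha> * ln t) powr lam \<le> \<alpha> powr (- \<bar>lam\<bar>) * (1 - ln t) powr lam"
proof -
  have l: "ln t < 0"
    using assms by simp
  have upper: "1 - \<alpha> * ln t \<le> 1 - ln t"
    using l assms by (simp add: mult_le_cancel_right1)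
  have lower: "\<alpha> * (1 - ln t) \<le> 1 - \<alpha> * ln t"
    using l assms by (simp add: algebra_simps)
  show ?thesis
  proof (cases "0 \<le> lam")
    case True
    have "1 - \<alpha> * ln t \<ge> 0"
      using lower l assms by (smt (verit) mult_nonneg_nonneg)
    then have "(1 - \<alpha> * ln t) powr lam \<le> 1 * (1 - ln t) powr lam"
      using powr_mono2[OF True _ upper] by simp
    also have "\<dots> \<le> \<alpha> powr (- \<bar>lam\<bar>) * (1 - ln t) powr lam"
      using powr_mono2'[of "- \<bar>lam\<bar>" \<alpha> 1] assms by (intro mult_right_mono) auto
    finally show ?thesis .
  next
    case False
    have "0 < \<alpha> * (1 - ln t)"
      using l assms by (intro mult_pos_pos) linarith+
    then have "(1 - \<alpha> * ln t) powr lam \<le> (\<alpha> * (1 - ln t)) powr lam"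
      using False lower by (intro powr_mono2') auto
    then show ?thesis
      using False by (simp add: powr_mult)
  qed
qed

text \<open>Measurability comes for free from monotonicity of the K-functional in \<open>t\<close>. It is stated for
  Borel sets because Borel measurability survives the composition with \<open>t\<^sup>\<alpha>\<close>.\<close>

lemma interp_weight_measurable:
  assumes "normed_space X\<^sub>0" "normed_space X\<^sub>1" "g \<in> carr X\<^sub>0"
  shows "(\<lambda>t. t powr c * (1 - ln t) powr lam * K_fun X\<^sub>0 X\<^sub>1 g t)
           \<in> borel_measurable (restrict_space borel {0<..<1})"
proof -
  have "mono_on {0<..<1} (K_fun X\<^sub>0 X\<^sub>1 g)"
    by (rule mono_on_subset[OF K_fun_mono_on[OF assms]]) auto
  then have [measurable]: "K_fun X\<^sub>0 X\<^sub>1 g \<in> borel_measurable (restrict_space borel {0<..<1})"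
    by (rule borel_measurable_mono_on_fnc)
  have [measurable]: "(\<lambda>t::real. t) \<in> borel_measurable (restrict_space borel {0<..<1})"
    by (rule measurable_restrict_space1) simp
  show ?thesis
    by measurable
qed

lemma interp_norm_diff_finite:
  assumes X0: "normed_space X\<^sub>0" and X1: "normed_space X\<^sub>1" and p: "1 \<le> p"
    and a: "a \<in> carr X\<^sub>0" and b: "b \<in> carr X\<^sub>0"
    and fin: "interp_norm X\<^sub>0 X\<^sub>1 \<theta> p lam a < \<infinity>" "interp_norm X\<^sub>0 X\<^sub>1 \<theta> p lam b < \<infinity>"
  shows "interp_norm X\<^sub>0 X\<^sub>1 \<theta> p lam (a - b) < \<infinity>"
proof -
  have ab: "a - b \<in> carr X\<^sub>0"
    using a b by (rule subspace_diff[OF normed_spaceD(1)[OF X0]])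
  show ?thesis
    unfolding interp_norm_def
  proof (rule Lq_norm01_finite_add[OF p interp_weight_measurable[OF X0 X1 a]
        interp_weight_measurable[OF X0 X1 b] interp_weight_measurable[OF X0 X1 ab]])
    fix t :: real assume "t \<in> {0<..<1}"
    then have t: "0 \<le> t"
      by simp
    let ?w = "t powr (- \<theta> - enn2real (1 / p)) * (1 - ln t) powr lam"
    have "?w * K_fun X\<^sub>0 X\<^sub>1 (a - b) t \<le> ?w * (K_fun X\<^sub>0 X\<^sub>1 a t + K_fun X\<^sub>0 X\<^sub>1 b t)"
      using K_fun_diff_le[OF X0 X1 a b t] by (intro mult_left_mono) auto
    then show "\<bar>?w * K_fun X\<^sub>0 X\<^sub>1 (a - b) t\<bar> \<le>
        \<bar>?w * K_fun X\<^sub>0 X\<^sub>1 a t\<bar> + \<bar>?w * K_fun X\<^sub>0 X\<^sub>1 b t\<bar>"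
      using K_fun_nonneg[OF X0 X1 _ t] a b ab by (simp add: abs_mult distrib_left)
  qed (use fin in \<open>simp_all add: interp_norm_def\<close>)
qed

text \<open>
  The pointwise hypothesis of the substitution lemma is the product of three estimates at \<open>s = t\<^sup>\<alpha>\<close>:
  the given one for the K-functionals, the comparison of the logarithmic weights, and the identity
  \<open>\<alpha> (- \<theta> - \<alpha> r) = \<alpha> r (1 - \<alpha>) + \<alpha> (- \<theta> - r)\<close> for the exponents of \<open>t\<close>, where \<open>r = 1/p\<close>.
\<close>

lemma interp_norm_holder:
  assumes X0: "normed_space X\<^sub>0" and X1: "normed_space X\<^sub>1"
    and Y0: "normed_space Y\<^sub>0" and Y1: "normed_space Y\<^sub>1"
    and al: "0 < \<alpha>" "\<alpha> \<le> 1" and p: "1 \<le> p" and C: "0 \<le> C"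
    and g: "g \<in> carr X\<^sub>0" and h: "h \<in> carr Y\<^sub>0"
    and K: "\<And>t. 0 < t \<Longrightarrow> K_fun Y\<^sub>0 Y\<^sub>1 h (t powr \<alpha>) \<le> C * K_fun X\<^sub>0 X\<^sub>1 g t powr \<alpha>"
    and fin: "interp_norm X\<^sub>0 X\<^sub>1 \<theta> p lam g < \<infinity>"
  shows "interp_norm Y\<^sub>0 Y\<^sub>1 \<theta> (p / ennreal \<alpha>) (lam * \<alpha>) h
           \<le> ennreal (C * \<alpha> powr (- \<bar>lam\<bar> * \<alpha>) * enn2real (interp_norm X\<^sub>0 X\<^sub>1 \<theta> p lam g) powr \<alpha>)"
proof -
  define r where "r = enn2real (1 / p)"
  have r: "enn2real (1 / (p / ennreal \<alpha>)) = \<alpha> * r"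
  proof (cases p)
    case (real P)
    then have "1 \<le> P"
      using p by simp
    then show ?thesis
      using real al divide_ennreal[of 1 P] divide_ennreal[of P \<alpha>] divide_ennreal[of 1 "P / \<alpha>"]
      by (simp add: r_def ennreal_1[symmetric] del: ennreal_1)
  next
    case top
    then show ?thesis
      using al by (simp add: r_def ennreal_top_divide)
  qed
  show ?thesis
    unfolding interp_norm_def r r_def[symmetric]
  proof (rule Lq_norm01_holder_substitution[OF al p _ interp_weight_measurable[OF X0 X1 g]
        interp_weight_measurable[OF Y0 Y1 h]])
    show "0 \<le> C * \<alpha> powr (- \<bar>lam\<bar> * \<alpha>)"
      using C by simp
    show "0 \<le> t powr (- \<theta> - r) * (1 - ln t) powr lam * K_fun X\<^sub>0 X\<^sub>1 g t" if "t \<in> {0<..<1}" for t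
      using K_fun_nonneg[OF X0 X1 g, of t] that by simp
    show "0 \<le> t powr (- \<theta> - \<alpha> * r) * (1 - ln t) powr (lam * \<alpha>) * K_fun Y\<^sub>0 Y\<^sub>1 h t" if "t \<in> {0<..<1}" for t
      using K_fun_nonneg[OF Y0 Y1 h, of t] that by simp
    show "Lq_norm01 p (\<lambda>t. t powr (- \<theta> - r) * (1 - ln t) powr lam * K_fun X\<^sub>0 X\<^sub>1 g t) < \<infinity>"
      using fin by (simp add: interp_norm_def r_def)
    fix t :: real assume "t \<in> {0<..<1}"
    then have t: "0 < t" "t < 1"
      by auto
    have w1: "(t powr \<alpha>) powr (- \<theta> - \<alpha> * r) = t powr (\<alpha> * r * (1 - \<alpha>)) * (t powr (- \<theta> - r)) powr \<alpha>"
      by (simp add: powr_powr powr_add[symmetric] algebra_simps)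
    have "(1 - \<alpha> * ln t) powr (lam * \<alpha>) = ((1 - \<alpha> * ln t) powr lam) powr \<alpha>"
      by (simp add: powr_powr)
    also have "\<dots> \<le> (\<alpha> powr (- \<bar>lam\<bar>) * (1 - ln t) powr lam) powr \<alpha>"
      using log_weight_dilation[OF al t] al by (intro powr_mono2) auto
    also have "\<dots> = \<alpha> powr (- \<bar>lam\<bar> * \<alpha>) * ((1 - ln t) powr lam) powr \<alpha>"
      by (simp add: powr_mult powr_powr)
    finally have w2: "(1 - ln (t powr \<alpha>)) powr (lam * \<alpha>) \<le> \<alpha> powr (- \<bar>lam\<bar> * \<alpha>) * ((1 - ln t) powr lam) powr \<alpha>"
      using t by (simp add: ln_powr)
    have "(t powr \<alpha>) powr (- \<theta> - \<alpha> * r) * (1 - ln (t powr \<alpha>)) powr (lam * \<alpha>) * K_fun Y\<^sub>0 Y\<^sub>1 h (t powr \<alpha>)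
        \<le> (t powr (\<alpha> * r * (1 - \<alpha>)) * (t powr (- \<theta> - r)) powr \<alpha>) *
          (\<alpha> powr (- \<bar>lam\<bar> * \<alpha>) * ((1 - ln t) powr lam) powr \<alpha>) * (C * K_fun X\<^sub>0 X\<^sub>1 g t powr \<alpha>)"
      unfolding w1 using w2 K[OF t(1)] K_fun_nonneg[OF Y0 Y1 h, of "t powr \<alpha>"]
      by (intro mult_mono) auto
    also have "\<dots> = C * \<alpha> powr (- \<bar>lam\<bar> * \<alpha>) * t powr (\<alpha> * r * (1 - \<alpha>)) *
        (t powr (- \<theta> - r) * (1 - ln t) powr lam * K_fun X\<^sub>0 X\<^sub>1 g t) powr \<alpha>"
      by (simp only: powr_mult mult_ac)
    finally show "(t powr \<alpha>) powr (- \<theta> - \<alpha> * r) * (1 - ln (t powr \<alpha>)) powr (lam * \<alpha>) * K_fun Y\<^sub>0 Y\<^sub>1 h (t powr \<alpha>)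
        \<le> C * \<alpha> powr (- \<bar>lam\<bar> * \<alpha>) * t powr (\<alpha> * enn2real (1 / p) * (1 - \<alpha>)) *
        (t powr (- \<theta> - r) * (1 - ln t) powr lam * K_fun X\<^sub>0 X\<^sub>1 g t) powr \<alpha>"
      unfolding r_def .
  qed
qed

theorem theorem2p2:
  fixes X\<^sub>0 X\<^sub>1 :: "'v::real_vector nspace"
    and Y\<^sub>0 Y\<^sub>1 :: "'w::real_vector nspace"
    and \<T> :: "'v \<Rightarrow> 'w"
    and \<alpha> \<theta> lam :: real
    and p :: ennreal
  assumes "compatible_couple X\<^sub>0 X\<^sub>1"
    and "compatible_couple Y\<^sub>0 Y\<^sub>1"
    and "carr X\<^sub>1 \<subseteq> carr X\<^sub>0"
    and "carr Y\<^sub>1 \<subseteq> carr Y\<^sub>0"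
    and "0 < \<alpha>" and "\<alpha> \<le> 1"
    and "\<T> \<in> carr X\<^sub>0 \<rightarrow> carr Y\<^sub>0"
    and "\<T> \<in> carr X\<^sub>1 \<rightarrow> carr Y\<^sub>1"
    and "holderian \<alpha> X\<^sub>0 Y\<^sub>0 \<T>"
    and "holderian \<alpha> X\<^sub>1 Y\<^sub>1 \<T>"
    and "0 \<le> \<theta>" and "\<theta> \<le> 1"
    and "1 \<le> p"
    and "(norm_topology X\<^sub>0) closure_of (carr X\<^sub>1) = carr X\<^sub>0"
  shows "holderian \<alpha> (interp_space X\<^sub>0 X\<^sub>1 \<theta> p lam)
           (interp_space Y\<^sub>0 Y\<^sub>1 \<theta> (p / ennreal \<alpha>) (lam * \<alpha>)) \<T>"
proof -
  have X: "normed_space X\<^sub>0" "normed_space X\<^sub>1" and Y: "normed_space Y\<^sub>0" "normed_space Y\<^sub>1"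
    using assms(1,2) by (auto simp: compatible_couple_def)
  have sum_space: "{g\<^sub>0 + g\<^sub>1 | g\<^sub>0 g\<^sub>1. g\<^sub>0 \<in> carr Z\<^sub>0 \<and> g\<^sub>1 \<in> carr Z\<^sub>1} = carr Z\<^sub>0"
    if "normed_space Z\<^sub>0" "normed_space Z\<^sub>1" "carr Z\<^sub>1 \<subseteq> carr Z\<^sub>0" for Z\<^sub>0 Z\<^sub>1 :: "'z::real_vector nspace"
    using that normed_spaceD(1)[OF that(1)] subspace_0[OF normed_spaceD(1)[OF that(2)]]
    by (force intro: subspace_add)
  have carrX: "carr (interp_space X\<^sub>0 X\<^sub>1 \<theta> p lam) = {g \<in> carr X\<^sub>0. interp_norm X\<^sub>0 X\<^sub>1 \<theta> p lam g < \<infinity>}"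
    by (simp add: interp_space_def sum_space[OF X assms(3)])
  let ?NY = "interp_norm Y\<^sub>0 Y\<^sub>1 \<theta> (p / ennreal \<alpha>) (lam * \<alpha>)"
  have carrY: "carr (interp_space Y\<^sub>0 Y\<^sub>1 \<theta> (p / ennreal \<alpha>) (lam * \<alpha>)) = {g \<in> carr Y\<^sub>0. ?NY g < \<infinity>}"
    by (simp add: interp_space_def sum_space[OF Y assms(4)])
  obtain C where C: "0 < C" "\<And>a b t. \<lbrakk>a \<in> carr X\<^sub>0; b \<in> carr X\<^sub>0; 0 < t\<rbrakk> \<Longrightarrow>
      K_fun Y\<^sub>0 Y\<^sub>1 (\<T> a - \<T> b) (t powr \<alpha>) \<le> C * K_fun X\<^sub>0 X\<^sub>1 (a - b) t powr \<alpha>"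
    using K_fun_holder[OF X Y assms(3) assms(14) assms(5) assms(9) assms(10)] by metis
  let ?M = "C * \<alpha> powr (- \<bar>lam\<bar> * \<alpha>)"
  show ?thesis
    unfolding holderian_def
  proof (intro exI[of _ ?M] conjI ballI)
    show "0 < ?M"
      using C(1) assms(5) by simp
    fix a b
    assume "a \<in> carr (interp_space X\<^sub>0 X\<^sub>1 \<theta> p lam)" "b \<in> carr (interp_space X\<^sub>0 X\<^sub>1 \<theta> p lam)"
    then have a: "a \<in> carr X\<^sub>0" "interp_norm X\<^sub>0 X\<^sub>1 \<theta> p lam a < \<infinity>"
      and b: "b \<in> carr X\<^sub>0" "interp_norm X\<^sub>0 X\<^sub>1 \<theta> p lam b < \<infinity>"
      unfolding carrX by auto
    have ab: "a - b \<in> carr X\<^sub>0"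
      using a b by (intro subspace_diff normed_spaceD(1)[OF X(1)])
    have Tab: "\<T> a - \<T> b \<in> carr Y\<^sub>0"
      using a b assms(7) by (auto intro!: subspace_diff normed_spaceD(1)[OF Y(1)])
    have fin: "interp_norm X\<^sub>0 X\<^sub>1 \<theta> p lam (a - b) < \<infinity>"
      by (rule interp_norm_diff_finite[OF X assms(13) a(1) b(1) a(2) b(2)])
    have le: "?NY (\<T> a - \<T> b) \<le> ennreal (?M * enn2real (interp_norm X\<^sub>0 X\<^sub>1 \<theta> p lam (a - b)) powr \<alpha>)"
      using C a b by (intro interp_norm_holder[OF X Y assms(5,6,13) _ ab Tab _ fin]) auto
    then have "?NY (\<T> a - \<T> b) < \<infinity>"
      by (rule le_less_trans) simp
    then show "\<T> a - \<T> b \<in> carr (interp_space Y\<^sub>0 Y\<^sub>1 \<theta> (p / ennreal \<alpha>) (lam * \<alpha>))"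
      unfolding carrY using Tab by simp
    show "nrm (interp_space Y\<^sub>0 Y\<^sub>1 \<theta> (p / ennreal \<alpha>) (lam * \<alpha>)) (\<T> a - \<T> b)
        \<le> ?M * nrm (interp_space X\<^sub>0 X\<^sub>1 \<theta> p lam) (a - b) powr \<alpha>"
      using enn2real_mono[OF le] C(1) by (simp add: interp_space_def)
  qed
qed

end
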